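(* The following two identities form a basis for the variety of MV-algebras, regarded as algebras $(A,\oplus,\neg)$ of type $\langle 2,1\rangle$: $$\neg (x \oplus (\neg x \oplus y)) \oplus z = z \tag{M1}$$ $$\neg (\neg (x \oplus y) \oplus \neg (z \oplus u)) \oplus \neg (z \oplus (u \oplus \neg (x \oplus (y \oplus (z \oplus u))))) = x \oplus y. \tag{M2}$$ That is: an algebra $(A,\oplus,\neg)$ of type $\langle 2,1\rangle$ (with $A$ nonempty) is an MV-algebra if and only if it satisfies (M1) for all $x,y,z\in A$ and (M2) for all $x,y,z,u\in A$; moreover the two identities are independent, i.e. there is an algebra of type $\langle 2,1\rangle$ satisfying (M1) but not (M2), and one satisfying (M2) but not (M1).
   Context: All algebras have nonempty carrier. An MV-algebra (with constant) is an algebra $(A,\oplus,\neg,0)$ of type $\langle 2,1,0\rangle$ satisfying, for all $x,y,z\in A$: (A1) $(x\oplus y)\oplus z = x\oplus (y\oplus z)$; (A2) $x\oplus y = y\oplus x$; (A3) $x\oplus 0 = x$; (A4) $\neg\neg x = x$; (A5) $x\oplus \neg 0 = \neg 0$; (A6) $\neg(\neg x\oplus y)\oplus y = \neg(\neg y\oplus x)\oplus x$. In every MV-algebra $0 = \neg(\neg x\oplus x)$ for all $x$, so the constant $0$ is determined by $\oplus$ and $\neg$ and may be dropped from the signature. Accordingly, an algebra $(A,\oplus,\neg)$ of type $\langle 2,1\rangle$ is called an MV-algebra if there is an element $0\in A$ such that $(A,\oplus,\neg,0)$ satisfies (A1)--(A6). A set of identities is a basis for a variety if the identities are independent (no one of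 them follows from the others) and the algebras of the given type satisfying all of them are exactly the members of the variety. *)

theory Defs
  imports Main
begin

text \<open>
  Algebras are given by a carrier set, so that the existence statements about independence
  can be made over one fixed ambient type. All laws are relativised to the carrier; the
  operations are unconstrained outside of it.
\<close>

locale algebra_2_1 =
  fixes A :: "'a set"
    and oplus :: "'a \<Rightarrow> 'a \<Rightarrow> 'a"  (infixl "\<oplus>" 65)
    and neg :: "'a \<Rightarrow> 'a"  ("\<sim> _" [81] 80)
  assumes carrier_nonempty: "A \<noteq> {}"
    and oplus_closed: "\<lbrakk>x \<in> A; y \<in> A\<rbrakk> \<Longrightarrow> x \<oplus> y \<in> A"
    and neg_closed: "x \<in> A \<Longrightarrow> \<sim> x \<in> A"

locale mv_algebra_with_zero = algebra_2_1 +
  fixes zero :: 'a  ("\<zero>")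
  assumes zero_closed: "\<zero> \<in> A"
    and A1: "\<lbrakk>x \<in> A; y \<in> A; z \<in> A\<rbrakk> \<Longrightarrow> (x \<oplus> y) \<oplus> z = x \<oplus> (y \<oplus> z)"
    and A2: "\<lbrakk>x \<in> A; y \<in> A\<rbrakk> \<Longrightarrow> x \<oplus> y = y \<oplus> x"
    and A3: "x \<in> A \<Longrightarrow> x \<oplus> \<zero> = x"
    and A4: "x \<in> A \<Longrightarrow> \<sim> (\<sim> x) = x"
    and A5: "x \<in> A \<Longrightarrow> x \<oplus> \<sim> \<zero> = \<sim> \<zero>"
    and A6: "\<lbrakk>x \<in> A; y \<in> A\<rbrakk> \<Longrightarrow> \<sim> (\<sim> x \<oplus> y) \<oplus> y = \<sim> (\<sim> y \<oplus> x) \<oplus> x"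

definition mv_algebra :: "'a set \<Rightarrow> ('a \<Rightarrow> 'a \<Rightarrow> 'a) \<Rightarrow> ('a \<Rightarrow> 'a) \<Rightarrow> bool" where
  "mv_algebra A oplus neg \<longleftrightarrow> (\<exists>zero. mv_algebra_with_zero A oplus neg zero)"

definition M1 :: "'a set \<Rightarrow> ('a \<Rightarrow> 'a \<Rightarrow> 'a) \<Rightarrow> ('a \<Rightarrow> 'a) \<Rightarrow> bool" where
  "M1 A oplus neg \<longleftrightarrow>
    (\<forall>x\<in>A. \<forall>y\<in>A. \<forall>z\<in>A. \<sim> (x \<oplus> (\<sim> x \<oplus> y)) \<oplus> z = z)"
  for oplus (infixl "\<oplus>" 65) and neg ("\<sim> _" [81] 80)

definition M2 :: "'a set \<Rightarrow> ('a \<Rightarrow> 'a \<Rightarrow> 'a) \<Rightarrow> ('a \<Rightarrow> 'a) \<Rightarrow> bool" where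
  "M2 A oplus neg \<longleftrightarrow>
    (\<forall>x\<in>A. \<forall>y\<in>A. \<forall>z\<in>A. \<forall>u\<in>A.
      \<sim> (\<sim> (x \<oplus> y) \<oplus> \<sim> (z \<oplus> u)) \<oplus> \<sim> (z \<oplus> (u \<oplus> \<sim> (x \<oplus> (y \<oplus> (z \<oplus> u))))) = x \<oplus> y)"
  for oplus (infixl "\<oplus>" 65) and neg ("\<sim> _" [81] 80)

end

theory Submission
  imports Defs
begin

text \<open>
  By (M1), every \<open>\<sim> (x \<oplus> (\<sim> x \<oplus> y))\<close> is a left identity; substituting left identities for
  \<open>x\<close> and \<open>z\<close> in (M2) gives \<open>\<sim> (\<sim> x \<oplus> \<sim> y) \<oplus> \<sim> (y \<oplus> \<sim> (x \<oplus> y)) = x\<close>, in MV-notation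
  \<open>(x \<odot> y) \<oplus> (x \<and> \<sim> y) = x\<close>. This identifies all the left identities with one element \<open>\<zero>\<close>,
  which is two-sided, and shows that \<open>\<sim>\<close> is an involution. It also yields the antisymmetry
  principle that \<open>\<sim> x \<oplus> y = \<sim> \<zero>\<close> and \<open>x \<oplus> \<sim> y = \<sim> \<zero>\<close> imply \<open>x = y\<close>. Commutativity and
  associativity are both proved by antisymmetry, the required inequalities coming from
  \<open>(x \<oplus> y) \<oplus> (z \<oplus> \<sim> (x \<oplus> (y \<oplus> z))) = \<sim> \<zero>\<close>. Independence is witnessed by a right-projection
  operation with constant negation and by a constant operation.
\<close>

section \<open>From the MV-axioms to (M1) and (M2)\<close>

context mv_algebra_with_zero
begin

lemma mv_left_zero: "x \<in> A \<Longrightarrow> \<zero> \<oplus> x = x"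
  using A2 A3 zero_closed by metis

lemma mv_oplus_neg:
  assumes "x \<in> A"
  shows "x \<oplus> \<sim> x = \<sim> \<zero>"
proof -
  have n: "\<sim> \<zero> \<in> A" "\<sim> x \<in> A" using assms zero_closed neg_closed by auto
  have "\<sim> \<zero> = \<sim> (\<sim> x \<oplus> \<sim> \<zero>) \<oplus> \<sim> \<zero>"
    using A5 n oplus_closed neg_closed by simp
  also have "\<dots> = \<sim> (\<sim> (\<sim> \<zero>) \<oplus> x) \<oplus> x" by (rule A6[OF assms n(1)])
  also have "\<dots> = \<sim> x \<oplus> x" using assms zero_closed by (simp add: A4 mv_left_zero)
  finally show ?thesis using A2 assms n by simp
qed

lemma mv_left_identity:
  assumes "x \<in> A" "y \<in> A" "z \<in> A"
  shows "\<sim> (x \<oplus> (\<sim> x \<oplus> y)) \<oplus> z = z"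
proof -
  have "x \<oplus> (\<sim> x \<oplus> y) = \<sim> \<zero> \<oplus> y"
    using A1[of x "\<sim> x" y] assms neg_closed by (simp add: mv_oplus_neg)
  also have "\<dots> = \<sim> \<zero>"
    using A2[of "\<sim> \<zero>" y] A5 assms zero_closed neg_closed by simp
  finally show ?thesis using assms zero_closed by (simp add: A4 mv_left_zero)
qed

text \<open>Modulo associativity this is (M2) for \<open>a = x \<oplus> y\<close> and
  \<open>b = z \<oplus> u\<close>. Two uses of (A6) turn the left side into the join of
  \<open>d\<close> and \<open>a\<close>, which is \<open>a\<close> because \<open>d\<close> lies
  below \<open>a\<close>.\<close>

lemma mv_decomposition:
  assumes a: "a \<in> A" and b: "b \<in> A"
  shows "\<sim> (\<sim> a \<oplus> \<sim> b) \<oplus> \<sim> (b \<oplus> \<sim> (a \<oplus> b)) = a"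
proof -
  note [simp] = a b zero_closed oplus_closed neg_closed
  define d where "d = \<sim> (\<sim> a \<oplus> \<sim> b)"
  have [simp]: "d \<in> A" by (simp add: d_def)
  have "b \<oplus> \<sim> (a \<oplus> b) = \<sim> (\<sim> (\<sim> a) \<oplus> b) \<oplus> b"
    by (simp add: A4 A2)
  also have "\<dots> = \<sim> (\<sim> b \<oplus> \<sim> a) \<oplus> \<sim> a" by (rule A6) simp_all
  also have "\<dots> = \<sim> a \<oplus> d" by (simp add: d_def A2)
  finally have "d \<oplus> \<sim> (b \<oplus> \<sim> (a \<oplus> b)) = \<sim> (\<sim> a \<oplus> d) \<oplus> d" by (simp add: A2)
  also have "\<dots> = \<sim> (\<sim> d \<oplus> a) \<oplus> a" by (rule A6) simp_all
  also have "\<sim> d \<oplus> a = \<sim> b \<oplus> (a \<oplus> \<sim> a)"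
    by (simp add: d_def A4) (metis A1 A2 a b neg_closed)
  also have "\<dots> = \<sim> \<zero>" by (simp add: mv_oplus_neg A5)
  finally show ?thesis by (simp add: d_def A4 mv_left_zero)
qed

lemma mv_M1: "M1 A oplus neg"
  by (simp add: M1_def mv_left_identity)

lemma mv_M2: "M2 A oplus neg"
  unfolding M2_def
proof (intro ballI)
  fix x y z u assume [simp]: "x \<in> A" "y \<in> A" "z \<in> A" "u \<in> A"
  note [simp] = oplus_closed neg_closed
  have "z \<oplus> (u \<oplus> \<sim> (x \<oplus> (y \<oplus> (z \<oplus> u)))) = (z \<oplus> u) \<oplus> \<sim> ((x \<oplus> y) \<oplus> (z \<oplus> u))"
    by (simp add: A1)
  then show "\<sim> (\<sim> (x \<oplus> y) \<oplus> \<sim> (z \<oplus> u)) \<oplus> \<sim> (z \<oplus> (u \<oplus> \<sim> (x \<oplus> (y \<oplus> (z \<oplus> u))))) = x \<oplus> y"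
    by (simp add: mv_decomposition)
qed

end

section \<open>Zero, one and the involution from (M1) and (M2)\<close>

locale M1_M2_algebra = algebra_2_1 +
  assumes M1: "M1 A oplus neg" and M2: "M2 A oplus neg"
begin

declare oplus_closed [simp] neg_closed [simp]

lemma left_identity:
  "\<lbrakk>x \<in> A; y \<in> A; z \<in> A\<rbrakk> \<Longrightarrow> \<sim> (x \<oplus> (\<sim> x \<oplus> y)) \<oplus> z = z"
  using M1 by (simp add: M1_def)

lemma decomposition4:
  "\<lbrakk>x \<in> A; y \<in> A; z \<in> A; u \<in> A\<rbrakk> \<Longrightarrow>
    \<sim> (\<sim> (x \<oplus> y) \<oplus> \<sim> (z \<oplus> u)) \<oplus> \<sim> (z \<oplus> (u \<oplus> \<sim> (x \<oplus> (y \<oplus> (z \<oplus> u))))) = x \<oplus> y"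
  using M2 by (simp add: M2_def)

lemma decomposition:
  assumes [simp]: "x \<in> A" "y \<in> A"
  shows "\<sim> (\<sim> x \<oplus> \<sim> y) \<oplus> \<sim> (y \<oplus> \<sim> (x \<oplus> y)) = x"
proof -
  define e where "e = \<sim> (x \<oplus> (\<sim> x \<oplus> x))"
  have [simp]: "e \<in> A" and [simp]: "\<And>v. v \<in> A \<Longrightarrow> e \<oplus> v = v"
    by (simp_all add: e_def left_identity)
  show ?thesis using decomposition4[of e x e y] by simp
qed

lemma left_identity_eq:
  assumes [simp]: "x \<in> A" "y \<in> A" "z \<in> A"
  shows "\<sim> (x \<oplus> (\<sim> x \<oplus> y)) = \<sim> (z \<oplus> \<sim> z)"
proof -
  define e where "e = \<sim> (x \<oplus> (\<sim> x \<oplus> y))"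
  have [simp]: "e \<in> A" and e: "\<And>v. v \<in> A \<Longrightarrow> e \<oplus> v = v"
    by (simp_all add: e_def left_identity)
  \<comment> \<open>This removes the first summand when \<open>e\<close> is decomposed along
    \<open>z\<close>, leaving \<open>e = \<sim> (z \<oplus> \<sim> z)\<close>.\<close>
  have "\<sim> (\<sim> e \<oplus> \<sim> z) \<oplus> v = v" if "v \<in> A" for v
    using left_identity[of e "\<sim> z" v] that by (simp add: e)
  then show ?thesis using decomposition[of e z] by (simp add: e flip: e_def)
qed

definition zero :: 'a  ("\<zero>")
  where "\<zero> = (let z = SOME z. z \<in> A in \<sim> (z \<oplus> \<sim> z))"

abbreviation one :: 'a  ("\<one>")
  where "\<one> \<equiv> \<sim> \<zero>"

lemma neg_oplus_neg:
  assumes "x \<in> A"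
  shows "\<sim> (x \<oplus> \<sim> x) = \<zero>"
proof -
  have "(SOME z. z \<in> A) \<in> A" using assms by (rule someI)
  then show ?thesis
    unfolding zero_def Let_def using left_identity_eq assms by metis
qed

lemma zero_closed [simp]: "\<zero> \<in> A"
  using carrier_nonempty neg_oplus_neg neg_closed oplus_closed by (metis ex_in_conv)

lemma neg_oplus_neg_oplus: "\<lbrakk>x \<in> A; y \<in> A\<rbrakk> \<Longrightarrow> \<sim> (x \<oplus> (\<sim> x \<oplus> y)) = \<zero>"
  using left_identity_eq[of x y x] by (simp add: neg_oplus_neg)

lemma zero_left [simp]: "x \<in> A \<Longrightarrow> \<zero> \<oplus> x = x"
  using left_identity[of x x x] by (simp add: neg_oplus_neg_oplus)

text \<open>The form of the involution law available while \<open>\<zero>\<close> is only a left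
  identity; it leads to \<open>zero_right\<close>, which then removes the extra zero.\<close>

lemma neg_neg_oplus_zero: "x \<in> A \<Longrightarrow> \<sim> (\<sim> x \<oplus> \<zero>) = x"
  using decomposition[of x "\<sim> x"] by (simp add: neg_oplus_neg)

lemma eq_one:
  assumes "x \<in> A" "\<sim> x = \<zero>"
  shows "x = \<one>"
  using neg_neg_oplus_zero[of x] assms by simp

lemma oplus_neg [simp]: "x \<in> A \<Longrightarrow> x \<oplus> \<sim> x = \<one>"
  by (simp add: eq_one neg_oplus_neg)

lemma oplus_neg_oplus [simp]: "\<lbrakk>x \<in> A; y \<in> A\<rbrakk> \<Longrightarrow> x \<oplus> (\<sim> x \<oplus> y) = \<one>"
  by (simp add: eq_one neg_oplus_neg_oplus)

lemma one_left [simp]: "x \<in> A \<Longrightarrow> \<one> \<oplus> x = \<one>"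
  by (metis oplus_neg_oplus zero_left zero_closed neg_closed oplus_closed)

lemma neg_one [simp]: "\<sim> \<one> = \<zero>"
  using neg_oplus_neg[of \<zero>] by simp

lemma zero_right [simp]:
  assumes "x \<in> A"
  shows "x \<oplus> \<zero> = x"
  using decomposition[of x \<one>] assms by (simp add: neg_neg_oplus_zero)

lemma neg_neg [simp]: "x \<in> A \<Longrightarrow> \<sim> (\<sim> x) = x"
  using neg_neg_oplus_zero[of x] by simp

lemma neg_oplus [simp]: "x \<in> A \<Longrightarrow> \<sim> x \<oplus> x = \<one>"
  using oplus_neg[of "\<sim> x"] by simp

lemma neg_oplus_oplus [simp]: "\<lbrakk>x \<in> A; y \<in> A\<rbrakk> \<Longrightarrow> \<sim> x \<oplus> (x \<oplus> y) = \<one>"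
  using oplus_neg_oplus[of "\<sim> x" y] by simp

lemma one_right [simp]: "x \<in> A \<Longrightarrow> x \<oplus> \<one> = \<one>"
  using oplus_neg_oplus[of x x] by simp

section \<open>Order and join without commutativity\<close>

lemma decomposition3:
  assumes "x \<in> A" "y \<in> A" "z \<in> A"
  shows "\<sim> (\<sim> (x \<oplus> y) \<oplus> \<sim> z) \<oplus> \<sim> (z \<oplus> \<sim> (x \<oplus> (y \<oplus> z))) = x \<oplus> y"
  using decomposition4[of x y \<zero> z] assms by simp

lemma antisymmetry:
  assumes "x \<in> A" "y \<in> A" "\<sim> x \<oplus> y = \<one>" "x \<oplus> \<sim> y = \<one>"
  shows "x = y"
  using decomposition[of x "\<sim> y"] assms by simp

lemma oplus_oplus_neg_left [simp]:
  assumes "x \<in> A" "y \<in> A"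
  shows "(x \<oplus> y) \<oplus> \<sim> x = \<one>"
proof -
  have "\<sim> (x \<oplus> y) \<oplus> \<sim> (\<sim> y \<oplus> \<sim> (\<sim> x \<oplus> \<sim> y)) = \<sim> x"
    using decomposition[of "\<sim> x" "\<sim> y"] assms by simp
  then show ?thesis using oplus_neg_oplus assms by (metis neg_closed oplus_closed)
qed

lemma oplus_absorb_left:
  assumes "x \<in> A" "y \<in> A"
  shows "\<sim> (\<sim> (x \<oplus> y) \<oplus> x) \<oplus> x = x \<oplus> y"
  using decomposition[of "x \<oplus> y" "\<sim> x"] assms by simp

text \<open>Here \<open>decomposition3\<close> supplies
  \<open>x \<oplus> (y \<oplus> \<sim> y)\<close>, which is \<open>\<one>\<close> at once; the other
  bracketing is settled only in \<open>oplus_oplus_neg_right\<close>.\<close>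

lemma oplus_absorb_right:
  assumes "x \<in> A" "y \<in> A"
  shows "\<sim> (\<sim> (x \<oplus> y) \<oplus> y) \<oplus> y = x \<oplus> y"
  using decomposition3[of x y "\<sim> y"] assms by simp

lemma oplus_oplus_neg_oplus [simp]:
  assumes "x \<in> A" "y \<in> A"
  shows "x \<oplus> (y \<oplus> \<sim> (x \<oplus> y)) = \<one>"
  using decomposition4[of \<zero> \<zero> x y] assms by (simp add: eq_one)

lemma neg_decomposition:
  assumes "x \<in> A" "y \<in> A"
  shows "\<sim> (x \<oplus> \<sim> (x \<oplus> y)) \<oplus> \<sim> (x \<oplus> y) = \<sim> x"
  using decomposition[of "\<sim> x" "x \<oplus> y"] assms by simp

text \<open>In MV-notation: \<open>x \<oplus> \<sim> y = x \<oplus> (\<sim> x \<and> \<sim> y)\<close>.\<close>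

lemma oplus_meet:
  assumes "x \<in> A" "y \<in> A"
  shows "x \<oplus> \<sim> (y \<oplus> \<sim> (\<sim> x \<oplus> y)) = x \<oplus> \<sim> y"
  using decomposition3[of x "\<sim> y" "y \<oplus> \<sim> (\<sim> x \<oplus> y)"] decomposition[of "\<sim> x" y] assms
  by simp

text \<open>A first case of commutativity: when \<open>\<sim> x\<close> is decomposed along
  \<open>\<sim> w\<close>, the first summand vanishes, and negating the rest gives the summands of
  \<open>decomposition\<close> in reverse order.\<close>

lemma decomposition_swap:
  assumes "x \<in> A" "y \<in> A"
  shows "\<sim> (y \<oplus> \<sim> (x \<oplus> y)) \<oplus> \<sim> (\<sim> x \<oplus> \<sim> y) = x"
proof -
  define w where "w = y \<oplus> \<sim> (x \<oplus> y)"
  have [simp]: "w \<in> A" using assms by (simp add: w_def)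
  have "\<sim> x \<oplus> \<sim> w = \<sim> x \<oplus> \<sim> y" using oplus_meet[of "\<sim> x" y] assms by (simp add: w_def)
  moreover have "x \<oplus> w = \<one>" using assms by (simp add: w_def)
  ultimately have "\<sim> (\<sim> w \<oplus> \<sim> (\<sim> x \<oplus> \<sim> y)) = \<sim> x"
    using decomposition[of "\<sim> x" "\<sim> w"] assms by simp
  then show ?thesis using assms neg_neg by (metis neg_closed oplus_closed w_def)
qed

lemma oplus_neg_oplus_oplus [simp]:
  assumes "x \<in> A" "y \<in> A"
  shows "(y \<oplus> \<sim> (x \<oplus> y)) \<oplus> x = \<one>"
  using oplus_neg_oplus[of "y \<oplus> \<sim> (x \<oplus> y)" "\<sim> (\<sim> x \<oplus> \<sim> y)"] assms
  by (simp add: decomposition_swap)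

lemma oplus_neg_commute_left:
  assumes [simp]: "x \<in> A" "y \<in> A"
  shows "x \<oplus> \<sim> (x \<oplus> y) = \<sim> (x \<oplus> y) \<oplus> x"
proof -
  define w where "w = x \<oplus> \<sim> (x \<oplus> y)"
  have [simp]: "w \<in> A" by (simp add: w_def)
  have w: "\<sim> w \<oplus> \<sim> (x \<oplus> y) = \<sim> x"
    using neg_decomposition by (simp add: w_def)
  \<comment> \<open>Once this sum is \<open>\<one>\<close>, \<open>decomposition_swap\<close> of
    \<open>w\<close> along \<open>x \<oplus> y\<close> degenerates to the claim.\<close>
  have "w \<oplus> (x \<oplus> y) = w \<oplus> \<sim> (\<sim> (x \<oplus> y) \<oplus> x)"
    using oplus_meet[of w "\<sim> (x \<oplus> y)"] w by simp
  also have "\<dots> = \<one>"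
    using oplus_neg_oplus_oplus[of "\<sim> (\<sim> (x \<oplus> y) \<oplus> x)" x]
    by (simp add: oplus_absorb_left w_def)
  finally show ?thesis
    using decomposition_swap[of w "x \<oplus> y"] w by (simp flip: w_def)
qed

text \<open>Mirror image of \<open>oplus_meet\<close>: \<open>x\<close> is the negation of a sum
  that starts with the meet \<open>a\<close>, so it commutes with \<open>a\<close>.\<close>

lemma meet_oplus:
  assumes "x \<in> A" "y \<in> A"
  shows "\<sim> (y \<oplus> \<sim> (\<sim> x \<oplus> y)) \<oplus> x = x \<oplus> \<sim> y"
proof -
  define a where "a = \<sim> (y \<oplus> \<sim> (\<sim> x \<oplus> y))"
  have [simp]: "a \<in> A" using assms by (simp add: a_def)
  have "a \<oplus> \<sim> (x \<oplus> \<sim> y) = \<sim> x"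
    using decomposition_swap[of "\<sim> x" y] assms by (simp add: a_def)
  then have "a \<oplus> x = x \<oplus> a"
    using oplus_neg_commute_left[of a "\<sim> (x \<oplus> \<sim> y)"] assms by simp
  then show ?thesis using assms by (simp add: a_def oplus_meet)
qed

text \<open>This is (A6) up to the order of summands.\<close>

lemma join_commute:
  assumes "x \<in> A" "y \<in> A"
  shows "y \<oplus> \<sim> (\<sim> x \<oplus> y) = \<sim> (x \<oplus> \<sim> y) \<oplus> x"
proof -
  define w where "w = y \<oplus> \<sim> (\<sim> x \<oplus> y)"
  have [simp]: "w \<in> A" using assms by (simp add: w_def)
  have "\<sim> w \<oplus> \<sim> (x \<oplus> \<sim> y) = \<sim> x"
    using decomposition_swap[of "\<sim> x" y] assms by (simp add: w_def)
  then have "w = \<sim> (\<sim> w \<oplus> x) \<oplus> x"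
    using neg_decomposition[of "\<sim> w" "\<sim> (x \<oplus> \<sim> y)"] assms by simp
  then show ?thesis using meet_oplus assms by (simp add: w_def)
qed

lemma oplus_oplus_neg_oplus_swap [simp]:
  assumes "x \<in> A" "y \<in> A"
  shows "x \<oplus> (y \<oplus> \<sim> (y \<oplus> x)) = \<one>"
proof -
  have "y \<oplus> \<sim> (y \<oplus> x) = \<sim> x \<oplus> \<sim> (\<sim> y \<oplus> \<sim> x)"
    using join_commute[of y "\<sim> x"] oplus_neg_commute_left assms by simp
  then show ?thesis using assms by simp
qed

lemma oplus_neg_commute_right:
  assumes [simp]: "x \<in> A" "y \<in> A"
  shows "y \<oplus> \<sim> (x \<oplus> y) = \<sim> (x \<oplus> y) \<oplus> y"
proof -
  define t where "t = \<sim> (x \<oplus> y)"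
  have [simp]: "t \<in> A" by (simp add: t_def)
  have "\<sim> (t \<oplus> y) \<oplus> y = \<sim> t" by (simp add: t_def oplus_absorb_right)
  then have "\<sim> (t \<oplus> y) \<oplus> (y \<oplus> t) = \<one>"
    using oplus_oplus_neg_oplus[of "\<sim> (t \<oplus> y)" y] by simp
  then show ?thesis
    \<comment> \<open>The first summand vanishes by the previous fact; by
      \<open>oplus_oplus_neg_oplus_swap\<close> the second is \<open>y \<oplus> t\<close>.\<close>
    using decomposition3[of t y "\<sim> (y \<oplus> t)"] by (simp flip: t_def)
qed

lemma oplus_oplus_neg_right:
  assumes [simp]: "x \<in> A" "y \<in> A"
  shows "(x \<oplus> y) \<oplus> \<sim> y = \<one>"
proof -
  have "x \<oplus> y = \<sim> (y \<oplus> \<sim> (x \<oplus> y)) \<oplus> y"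
    by (simp add: oplus_absorb_right oplus_neg_commute_right)
  also have "\<dots> = (x \<oplus> y) \<oplus> \<sim> (\<sim> y \<oplus> (x \<oplus> y))"
    using join_commute[of y "x \<oplus> y"] by simp
  finally show ?thesis
    using oplus_neg_oplus_oplus[of "\<sim> y" "x \<oplus> y"] by simp
qed

section \<open>Associativity and commutativity\<close>

lemma oplus_assoc_bound:
  assumes "x \<in> A" "y \<in> A" "z \<in> A"
  shows "(x \<oplus> y) \<oplus> (z \<oplus> \<sim> (x \<oplus> (y \<oplus> z))) = \<one>"
  using oplus_oplus_neg_right[of "\<sim> (\<sim> (x \<oplus> y) \<oplus> \<sim> z)" "\<sim> (z \<oplus> \<sim> (x \<oplus> (y \<oplus> z)))"]
    decomposition3[of x y z] assms by simp

lemma oplus_assoc_one: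
  assumes "x \<in> A" "y \<in> A" "z \<in> A" "x \<oplus> (y \<oplus> z) = \<one>"
  shows "(x \<oplus> y) \<oplus> z = \<one>"
  using oplus_assoc_bound[of x y z] assms by simp

lemma oplus_commute:
  assumes [simp]: "x \<in> A" "y \<in> A"
  shows "x \<oplus> y = y \<oplus> x"
proof (rule antisymmetry)
  have *: "(u \<oplus> v) \<oplus> \<sim> (v \<oplus> u) = \<one>" if "u \<in> A" "v \<in> A" for u v
    using oplus_assoc_one[of u v "\<sim> (v \<oplus> u)"] that by simp
  show "(x \<oplus> y) \<oplus> \<sim> (y \<oplus> x) = \<one>" by (rule *) simp_all
  show "\<sim> (x \<oplus> y) \<oplus> (y \<oplus> x) = \<one>"
    using oplus_oplus_neg_oplus_swap[of "\<sim> (x \<oplus> y)" "y \<oplus> x"] by (simp add: *)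
qed simp_all

lemma oplus_assoc:
  assumes [simp]: "x \<in> A" "y \<in> A" "z \<in> A"
  shows "(x \<oplus> y) \<oplus> z = x \<oplus> (y \<oplus> z)"
proof (rule antisymmetry)
  have *: "((u \<oplus> v) \<oplus> w) \<oplus> \<sim> (u \<oplus> (v \<oplus> w)) = \<one>" if "u \<in> A" "v \<in> A" "w \<in> A" for u v w
    using oplus_assoc_one[of "u \<oplus> v" w "\<sim> (u \<oplus> (v \<oplus> w))"] oplus_assoc_bound that by simp
  show "((x \<oplus> y) \<oplus> z) \<oplus> \<sim> (x \<oplus> (y \<oplus> z)) = \<one>" by (rule *) simp_all
  \<comment> \<open>The same inequality with the variables reversed; commutativity turns it into the
    opposite one.\<close>
  have "((z \<oplus> y) \<oplus> x) \<oplus> \<sim> (z \<oplus> (y \<oplus> x)) = \<one>" by (rule *) simp_all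
  moreover have "(z \<oplus> y) \<oplus> x = x \<oplus> (y \<oplus> z)" "z \<oplus> (y \<oplus> x) = (x \<oplus> y) \<oplus> z"
    using oplus_commute assms oplus_closed by metis+
  ultimately show "\<sim> ((x \<oplus> y) \<oplus> z) \<oplus> (x \<oplus> (y \<oplus> z)) = \<one>"
    using oplus_commute[of "x \<oplus> (y \<oplus> z)" "\<sim> ((x \<oplus> y) \<oplus> z)"] by simp
qed simp_all

lemma mv_algebra_with_zero: "mv_algebra_with_zero A oplus neg \<zero>"
proof unfold_locales
  fix x y assume [simp]: "x \<in> A" "y \<in> A"
  show "\<sim> (\<sim> x \<oplus> y) \<oplus> y = \<sim> (\<sim> y \<oplus> x) \<oplus> x"
    using join_commute[of x y] oplus_commute[of y "\<sim> (\<sim> x \<oplus> y)"] oplus_commute[of x "\<sim> y"]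
    by simp
qed (auto simp: oplus_assoc intro: oplus_commute)

end

theorem theorem1p1:
  shows "(\<forall>(A :: 'a set) oplus neg. algebra_2_1 A oplus neg \<longrightarrow>
            (mv_algebra A oplus neg \<longleftrightarrow> M1 A oplus neg \<and> M2 A oplus neg))
       \<and> (\<exists>(A :: nat set) oplus neg. algebra_2_1 A oplus neg \<and> M1 A oplus neg \<and> \<not> M2 A oplus neg)
       \<and> (\<exists>(A :: nat set) oplus neg. algebra_2_1 A oplus neg \<and> M2 A oplus neg \<and> \<not> M1 A oplus neg)"
proof (intro conjI allI impI)
  fix A :: "'a set" and oplus neg
  assume alg: "algebra_2_1 A oplus neg"
  show "mv_algebra A oplus neg \<longleftrightarrow> M1 A oplus neg \<and> M2 A oplus neg"
  proof
    assume "mv_algebra A oplus neg"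
    then show "M1 A oplus neg \<and> M2 A oplus neg"
      by (auto simp: mv_algebra_def
          intro: mv_algebra_with_zero.mv_M1 mv_algebra_with_zero.mv_M2)
  next
    assume "M1 A oplus neg \<and> M2 A oplus neg"
    then have "M1_M2_algebra A oplus neg"
      using alg by (simp add: M1_M2_algebra_def M1_M2_algebra_axioms_def)
    then show "mv_algebra A oplus neg"
      unfolding mv_algebra_def by (blast intro: M1_M2_algebra.mv_algebra_with_zero)
  qed
next
  \<comment> \<open>(M2) fails for \<open>y = 1\<close>: its left side is a negation, hence
    0.\<close>
  have "algebra_2_1 {0, 1 :: nat} (\<lambda>x y. y) (\<lambda>x. 0)"
    "M1 {0, 1 :: nat} (\<lambda>x y. y) (\<lambda>x. 0)" "\<not> M2 {0, 1 :: nat} (\<lambda>x y. y) (\<lambda>x. 0)"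
    by (auto simp: algebra_2_1_def M1_def M2_def)
  then show "\<exists>(A :: nat set) oplus neg. algebra_2_1 A oplus neg \<and> M1 A oplus neg \<and> \<not> M2 A oplus neg"
    by blast
next
  \<comment> \<open>Both sides of (M2) are 0, whereas (M1) fails for \<open>z = 1\<close>.\<close>
  have "algebra_2_1 {0, 1 :: nat} (\<lambda>x y. 0) (\<lambda>x. 0)"
    "M2 {0, 1 :: nat} (\<lambda>x y. 0) (\<lambda>x. 0)" "\<not> M1 {0, 1 :: nat} (\<lambda>x y. 0) (\<lambda>x. 0)"
    by (auto simp: algebra_2_1_def M1_def M2_def)
  then show "\<exists>(A :: nat set) oplus neg. algebra_2_1 A oplus neg \<and> M2 A oplus neg \<and> \<not> M1 A oplus neg"
    by blast
qed

end
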